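(* Let $m,n,k$ be positive integers. (i) If $n\in\{2,3,4\}$ and $k\leq (n+1)m$, then $S_m(n,k)$ is word-representable. Moreover, $S_m(2,k)$ is not word-representable for every $k\geq 3m+1$. (ii) If $n\geq 5$ and $k\leq 2mn$, then $S_m(n,k)$ is word-representable.
   Context: For a positive integer $k$ let $A(k)=\{0,1,\ldots,k-1\}$. For integers $n\ge 2$ and $m\ge 0$ let $$A^n_m(k)=\{x_1x_2\ldots x_n : x_i\in A(k)\text{ for } 1\le i\le n \text{ and } |x_i-x_{i+1}|\ge m \text{ for } 1\le i\le n-1\},$$ a set of words of length $n$; in particular $A^n_0(k)$ is the set of all words of length $n$ over $A(k)$. The de Bruijn graph $B(n,k)$ is the directed graph with vertex set $A^n_0(k)$ having an arc from $x_1x_2\ldots x_n$ to $y_1y_2\ldots y_n$ if and only if $x_{i+1}=y_i$ for all $i\in\{1,\ldots,n-1\}$. The simplified de Bruijn graph $S(n,k)$ is the simple undirected graph obtained from $B(n,k)$ by removing orientations and loops and replacing multiple edges between a pair of vertices by a single edge. $S_m(n,k)$ denotes the subgraph of $S(n,k)$ induced by the vertex set $A^n_m(k)$. Word-representability: two distinct letters $x$ and $y$ alternate in a word $w$ if, after deleting from $w$ all letters other than the copies of $x$ and $y$, one obtains either a word $xyxy\cdots$ or a word $yxyx\cdots$ (of even or odd length). A simple graph $G=(V,E)$ is word-representable if there exists a (finite) word $w$ over the alphabet $V$, in which every letter of $V$ occurs, such that for all $x\ne y$ in $V$, the letters $x$ and $y$ alternate in $w$ if and only if $xy\in E$. *)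

theory Defs
  imports "Graph_Theory.Pair_Digraph"
begin

section \<open>Words\<close>

text \<open>
  Words are lists of natural numbers with letters in \<open>A(k) = {..<k}\<close>; the letter \<open>x\<^sub>i\<close> of
  \<open>x\<^sub>1x\<^sub>2\<dots>x\<^sub>n\<close> is \<open>x ! (i - 1)\<close>. The difference of letters is taken in \<open>int\<close>, since
  subtraction on \<open>nat\<close> truncates.
\<close>

definition gap_words :: "nat \<Rightarrow> nat \<Rightarrow> nat \<Rightarrow> nat list set" where
  "gap_words m n k = {x. length x = n \<and> set x \<subseteq> {..<k} \<and>
     (\<forall>i. i + 1 < n \<longrightarrow> \<bar>int (x ! i) - int (x ! (i + 1))\<bar> \<ge> int m)}"

section \<open>Simple undirected graphs\<close>

text \<open>A simple graph is a vertex set with a set of two-element sets of vertices as edges.\<close>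

datatype 'a ugraph = UGraph (vertices: "'a set") (edges: "'a set set")

definition simple_ugraph :: "'a ugraph \<Rightarrow> bool" where
  "simple_ugraph G \<longleftrightarrow>
     (\<forall>e\<in>edges G. \<exists>x\<in>vertices G. \<exists>y\<in>vertices G. x \<noteq> y \<and> e = {x, y})"

definition underlying_ugraph :: "'a pair_pre_digraph \<Rightarrow> 'a ugraph" where
  "underlying_ugraph D = UGraph (pverts D) {{x, y} | x y. (x, y) \<in> parcs D \<and> x \<noteq> y}"

definition induced_ugraph :: "'a ugraph \<Rightarrow> 'a set \<Rightarrow> 'a ugraph" where
  "induced_ugraph G U = UGraph (vertices G \<inter> U) {e \<in> edges G. e \<subseteq> U}"

section \<open>De Bruijn graphs\<close>

text \<open>\<open>gap_words 0 n k\<close> is the set of all words of length \<open>n\<close> over \<open>A(k)\<close>.\<close>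

definition de_bruijn :: "nat \<Rightarrow> nat \<Rightarrow> nat list pair_pre_digraph" where
  "de_bruijn n k = \<lparr> pverts = gap_words 0 n k,
     parcs = {(x, y). x \<in> gap_words 0 n k \<and> y \<in> gap_words 0 n k \<and>
                      (\<forall>i. i + 1 < n \<longrightarrow> x ! (i + 1) = y ! i)} \<rparr>"

definition simplified_de_bruijn :: "nat \<Rightarrow> nat \<Rightarrow> nat list ugraph" where
  "simplified_de_bruijn n k = underlying_ugraph (de_bruijn n k)"

definition gap_de_bruijn :: "nat \<Rightarrow> nat \<Rightarrow> nat \<Rightarrow> nat list ugraph" where
  "gap_de_bruijn m n k = induced_ugraph (simplified_de_bruijn n k) (gap_words m n k)"

section \<open>Word-representability\<close>

text \<open>\<open>alternating x y l\<close> is the word \<open>xyxy\<dots>\<close> of length \<open>l\<close>.\<close>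

definition alternating :: "'a \<Rightarrow> 'a \<Rightarrow> nat \<Rightarrow> 'a list" where
  "alternating x y l = map (\<lambda>i. if even i then x else y) [0..<l]"

definition alternate_in :: "'a \<Rightarrow> 'a \<Rightarrow> 'a list \<Rightarrow> bool" where
  "alternate_in x y w \<longleftrightarrow>
     (\<exists>l. filter (\<lambda>z. z \<in> {x, y}) w = alternating x y l \<or>
          filter (\<lambda>z. z \<in> {x, y}) w = alternating y x l)"

text \<open>
  The graph without vertices is represented by the empty word.
\<close>

definition word_representable :: "'a ugraph \<Rightarrow> bool" where
  "word_representable G \<longleftrightarrow>
     (\<exists>w. set w = vertices G \<and>
          (\<forall>x\<in>vertices G. \<forall>y\<in>vertices G. x \<noteq> y \<longrightarrow>
             (alternate_in x y w \<longleftrightarrow> {x, y} \<in> edges G)))"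

section \<open>Sanity checks\<close>

lemma vertices_gap_de_bruijn: "vertices (gap_de_bruijn m n k) = gap_words m n k"
  by (auto simp: gap_de_bruijn_def induced_ugraph_def simplified_de_bruijn_def
      underlying_ugraph_def de_bruijn_def gap_words_def)

lemma simple_gap_de_bruijn: "simple_ugraph (gap_de_bruijn m n k)"
  unfolding simple_ugraph_def vertices_gap_de_bruijn
  by (auto simp: gap_de_bruijn_def induced_ugraph_def simplified_de_bruijn_def
      underlying_ugraph_def)

lemma edge_gap_de_bruijn_iff:
  "{x, y} \<in> edges (gap_de_bruijn m n k) \<longleftrightarrow>
     x \<in> gap_words m n k \<and> y \<in> gap_words m n k \<and> x \<noteq> y \<and>
     ((\<forall>i. i + 1 < n \<longrightarrow> x ! (i + 1) = y ! i) \<or> (\<forall>i. i + 1 < n \<longrightarrow> y ! (i + 1) = x ! i))"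
proof -
  have "x \<in> gap_words 0 n k" if "x \<in> gap_words m n k" for x
    using that by (auto simp: gap_words_def)
  then show ?thesis
    by (auto simp: gap_de_bruijn_def induced_ugraph_def simplified_de_bruijn_def
        underlying_ugraph_def de_bruijn_def doubleton_eq_iff)
qed

end

theory Submission
  imports Defs "HOL-Library.Sublist"
begin

text \<open>
  Replacing every letter \<open>c\<close> by \<open>c div m\<close> turns the words of the graph into words whose consecutive
  letters differ, so for the positive part it suffices to colour such words of length \<open>n\<close> properly
  by three colours; three-colourable graphs are word-representable. The colours come from the
  following reduction: if letters are encoded by an antichain \<open>S\<close> of sets of new letters, then
  replacing each pair \<open>ab\<close> by an element of \<open>S a - S b\<close> shortens words by one letter, and the
  number of letters drops from \<open>c choose 2\<close> to \<open>c\<close>.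

  For the negative part, the words over \<open>{0, m, 2m, 3m}\<close> induce \<open>S\<^sub>1(2, 4)\<close>. Orient an edge from the
  vertex that occurs first in a representing word. The resulting orientation has neither directed cycles nor shortcuts
  along directed paths. This forces the orientation of \<open>ab - bc\<close> to depend, for each \<open>b\<close>, only on
  \<open>a\<close> or only on \<open>c\<close>, which contradicts the constraints from the cycles \<open>ab, bc, cd, da\<close>.
\<close>

section \<open>Alternation\<close>

lemma length_alternating [simp]: "length (alternating x y l) = l"
  by (simp add: alternating_def)

lemma alternating_0 [simp]: "alternating x y 0 = []"
  by (simp add: alternating_def)

lemma alternating_Suc: "alternating x y (Suc l) = alternating x y l @ [if even l then x else y]"
  by (simp add: alternating_def)

lemma alternating_Suc': "alternating x y (Suc l) = x # alternating y x l"
  by (rule nth_equalityI) (auto simp: alternating_def nth_Cons split: nat.split simp del: upt_Suc)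

lemma distinct_adj_alternating: "x \<noteq> y \<Longrightarrow> distinct_adj (alternating x y l)"
proof (induction l arbitrary: x y)
  case (Suc l)
  then show ?case
    by (cases l) (auto simp: alternating_Suc')
qed simp

lemma distinct_adj_imp_alternating:
  "set xs \<subseteq> {x, y} \<Longrightarrow> distinct_adj xs \<Longrightarrow> xs \<noteq> [] \<Longrightarrow> hd xs = x \<Longrightarrow>
   xs = alternating x y (length xs)"
proof (induction xs arbitrary: x y)
  case (Cons a xs)
  show ?case
  proof (cases xs)
    case (Cons b ys)
    with Cons.prems have "b = y" "a = x" by auto
    with Cons Cons.prems have "xs = alternating y x (length xs)"
      by (intro Cons.IH) auto
    then show ?thesis using \<open>a = x\<close> by (simp add: alternating_Suc')
  qed (use Cons.prems in \<open>auto simp: alternating_Suc'\<close>)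
qed simp

text \<open>This local form passes to factors of a word and can be checked at the seams of a
  concatenation.\<close>

lemma alternate_in_iff_distinct_adj:
  assumes "x \<noteq> y"
  shows "alternate_in x y w \<longleftrightarrow> distinct_adj (filter (\<lambda>z. z \<in> {x, y}) w)" (is "_ \<longleftrightarrow> distinct_adj ?f")
proof
  assume "alternate_in x y w"
  then show "distinct_adj ?f"
    unfolding alternate_in_def using assms by (metis distinct_adj_alternating)
next
  assume d: "distinct_adj ?f"
  show "alternate_in x y w"
  proof (cases "?f = []")
    case True
    then show ?thesis unfolding alternate_in_def by (intro exI[of _ 0]) simp
  next
    case False
    then have "hd ?f \<in> set ?f" by (rule hd_in_set)
    then have "hd ?f = x \<or> hd ?f = y" by auto
    moreover have "set ?f \<subseteq> {x, y}" "set ?f \<subseteq> {y, x}" by auto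
    ultimately show ?thesis
      unfolding alternate_in_def using d False distinct_adj_imp_alternating by metis
  qed
qed

text \<open>Counting in prefixes makes chains of alternating pairs a matter of linear inequalities;
  \<open>leads w x y\<close> means that \<open>x\<close> and \<open>y\<close> alternate in \<open>w\<close>, starting with \<open>x\<close>.\<close>

definition leads :: "'a list \<Rightarrow> 'a \<Rightarrow> 'a \<Rightarrow> bool" where
  "leads w x y \<longleftrightarrow> (\<forall>p. prefix p w \<longrightarrow>
     count_list p y \<le> count_list p x \<and> count_list p x \<le> count_list p y + 1)"

text \<open>Appending a letter adds a single new prefix, hence the induction from the right; the
  difference of the counts, 0 or 1, tells whether \<open>x\<close> or \<open>y\<close> must come
  next.\<close>

lemma leads_iff_alternating:
  assumes "x \<noteq> y"
  shows "leads w x y \<longleftrightarrow>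
    filter (\<lambda>z. z \<in> {x, y}) w = alternating x y (count_list w x + count_list w y) \<and>
    count_list w y \<le> count_list w x \<and> count_list w x \<le> count_list w y + 1"
proof (induction w rule: rev_induct)
  case Nil
  then show ?case by (simp add: leads_def)
next
  case (snoc z w)
  have *: "leads (w @ [z]) x y \<longleftrightarrow> leads w x y \<and>
      count_list (w @ [z]) y \<le> count_list (w @ [z]) x \<and>
      count_list (w @ [z]) x \<le> count_list (w @ [z]) y + 1"
    unfolding leads_def prefix_snoc by auto
  show ?case
    unfolding * snoc.IH using assms by (auto simp: alternating_Suc)
      (presburger | fastforce)+
qed

lemma count_list_filter_eq: "P x \<Longrightarrow> count_list (filter P w) x = count_list w x"
  by (induction w) auto

lemma count_list_alternating:
  assumes "x \<noteq> y"
  shows "count_list (alternating x y l) x = (l + 1) div 2" "count_list (alternating x y l) y = l div 2"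
  using assms by (induction l) (auto simp: alternating_Suc)

lemma leads_if_filter_eq:
  assumes "x \<noteq> y" "filter (\<lambda>z. z \<in> {x, y}) w = alternating x y l"
  shows "leads w x y"
proof -
  have "count_list w x = (l + 1) div 2" "count_list w y = l div 2"
    using assms(2) count_list_alternating[OF assms(1), of l] count_list_filter_eq[of "\<lambda>z. z \<in> {x, y}" x w]
      count_list_filter_eq[of "\<lambda>z. z \<in> {x, y}" y w] by simp_all
  then have "count_list w x + count_list w y = l" "count_list w y \<le> count_list w x"
    "count_list w x \<le> count_list w y + 1" by linarith+
  then show ?thesis
    using assms by (simp add: leads_iff_alternating)
qed

lemma alternate_in_iff_leads:
  assumes "x \<noteq> y"
  shows "alternate_in x y w \<longleftrightarrow> leads w x y \<or> leads w y x"
proof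
  assume "alternate_in x y w"
  then show "leads w x y \<or> leads w y x"
    unfolding alternate_in_def using assms leads_if_filter_eq[of x y w] leads_if_filter_eq[of y x w]
    by (auto simp: insert_commute)
next
  assume "leads w x y \<or> leads w y x"
  then show "alternate_in x y w"
    unfolding alternate_in_def using assms leads_iff_alternating[of x y w] leads_iff_alternating[of y x w]
    by (auto simp: insert_commute)
qed

text \<open>The two counts agree on every prefix, yet an occurrence of \<open>x\<close> would change
  only one of them if the letters differed.\<close>

lemma leads_antisym:
  assumes "leads w x y" "leads w y x" "x \<in> set w"
  shows "x = y"
proof (rule ccontr)
  assume "x \<noteq> y"
  obtain p q where "w = p @ x # q" using assms(3) by (meson split_list)
  then have "prefix p w" "prefix (p @ [x]) w" by auto
  then have "count_list p x = count_list p y" "count_list (p @ [x]) x = count_list (p @ [x]) y"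
    using assms unfolding leads_def by (meson le_antisym)+
  with \<open>x \<noteq> y\<close> show False by simp
qed

text \<open>Within a prefix the count never increases along an arc, so on a closed walk all counts
  are equal.\<close>

lemma no_closed_4_walk:
  assumes "leads w x y" "leads w y z" "leads w z u" "leads w u x" "x \<in> set w"
  shows "x = y"
proof -
  have "leads w y x"
    unfolding leads_def
  proof (intro allI impI)
    fix p assume "prefix p w"
    then show "count_list p x \<le> count_list p y \<and> count_list p y \<le> count_list p x + 1"
      using assms(1-4)[unfolded leads_def, rule_format, of p] by linarith
  qed
  with assms show ?thesis by (blast dest: leads_antisym)
qed

text \<open>An instance of semi-transitivity: the counts decrease weakly along the path, and the arc
  from \<open>x\<close> to \<open>u\<close> bounds the whole drop by 1, hence also the drop from
  \<open>x\<close> to \<open>z\<close>.\<close>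

lemma leads_shortcut:
  assumes "leads w x y" "leads w y z" "leads w z u" "leads w x u"
  shows "leads w x z"
  unfolding leads_def
proof (intro allI impI)
  fix p assume "prefix p w"
  then show "count_list p z \<le> count_list p x \<and> count_list p x \<le> count_list p z + 1"
    using assms[unfolded leads_def, rule_format, of p] by linarith
qed

section \<open>Three-colourable graphs\<close>

lemma filter_pair_filter:
  assumes "distinct vs" "u \<in> set vs" "v \<in> set vs" "\<not> (P u \<and> P v)"
  shows "filter (\<lambda>z. z \<in> {u, v}) (filter P vs) = (if P u then [u] else if P v then [v] else [])"
proof -
  have one: "filter (\<lambda>z. z = x) vs = [x]" if "x \<in> set vs" for x
    using assms(1) that by (induction vs) (auto simp: filter_empty_conv)
  have "filter (\<lambda>z. z \<in> {u, v}) (filter P vs) =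
    filter (\<lambda>z. z = (if P u then u else v) \<and> (P u \<or> P v)) vs"
    using assms(4) by (auto intro!: filter_cong)
  then show ?thesis
    using assms one by (auto simp: filter_empty_conv)
qed

lemma distinct_adj_appendD:
  "distinct_adj (xs @ ys @ zs) \<Longrightarrow> distinct_adj ys"
  by (simp add: distinct_adj_append_iff)

text \<open>Every factor begins with \<open>u\<close> and ends with \<open>v\<close>, so no letter
  is doubled at a seam.\<close>

lemma distinct_adj_concat:
  assumes "u \<noteq> v" "\<And>l. l \<in> set ls \<Longrightarrow> l = [u, v] \<or> l = [u, v, u, v]"
  shows "distinct_adj (concat ls) \<and> (ls \<noteq> [] \<longrightarrow> concat ls \<noteq> [] \<and> hd (concat ls) = u)"
  using assms(2)
proof (induction ls)
  case (Cons l ls)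
  have "l = [u, v] \<or> l = [u, v, u, v]" using Cons.prems by simp
  then have l: "distinct_adj l" "l \<noteq> []" "hd l = u" "last l = v" using assms(1) by auto
  have "distinct_adj (concat ls) \<and> (ls \<noteq> [] \<longrightarrow> concat ls \<noteq> [] \<and> hd (concat ls) = u)"
    using Cons.prems by (intro Cons.IH) simp
  with l assms(1) show ?case
    by (cases "ls = []") (simp_all add: distinct_adj_append_iff)
qed simp

text \<open>The representing word is a concatenation of factors, each of which respects all edges and
  breaks the alternation of one prescribed non-edge.\<close>

lemma word_representable_if_factors:
  assumes fin: "finite V"
    and proper: "\<And>x y. {x, y} \<in> edges G \<Longrightarrow> x \<in> V \<Longrightarrow> y \<in> V \<Longrightarrow> f x \<noteq> (f y :: nat)"
    and V: "vertices G = V"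
    and set_F: "\<And>x y. x \<in> V \<Longrightarrow> y \<in> V \<Longrightarrow> set (F x y) = V"
    and edge: "\<And>x y u v. x \<in> V \<Longrightarrow> y \<in> V \<Longrightarrow> {x, y} \<notin> edges G \<Longrightarrow> u \<in> V \<Longrightarrow> v \<in> V \<Longrightarrow>
      {u, v} \<in> edges G \<Longrightarrow> f u < f v \<Longrightarrow> filter (\<lambda>z. z \<in> {u, v}) (F x y) \<in> {[u, v], [u, v, u, v]}"
    and nonedge: "\<And>x y. x \<in> V \<Longrightarrow> y \<in> V \<Longrightarrow> x \<noteq> y \<Longrightarrow> f x \<le> f y \<Longrightarrow> {x, y} \<notin> edges G \<Longrightarrow>
      \<not> distinct_adj (filter (\<lambda>z. z \<in> {x, y}) (F x y))"
  shows "word_representable G"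
proof -
  \<comment> \<open>Diagonal pairs are included on purpose: \<open>{x}\<close> is never an edge, so
    a nonempty graph yields at least one factor even if it is complete.\<close>
  obtain ps where ps: "set ps = {(x, y). x \<in> V \<and> y \<in> V \<and> {x, y} \<notin> edges G}"
    using finite_list[of "{(x, y). x \<in> V \<and> y \<in> V \<and> {x, y} \<notin> edges G}"]
      finite_subset[of "{(x, y). x \<in> V \<and> y \<in> V \<and> {x, y} \<notin> edges G}" "V \<times> V"] fin by auto
  define w where "w = concat (map (case_prod F) ps)"
  have loop: "{x} \<notin> edges G" if "x \<in> V" for x
    using proper[of x x] that by auto
  have set_w: "set w = V"
  proof
    show "set w \<subseteq> V" unfolding w_def using set_F ps by auto
    show "V \<subseteq> set w"
    proof
      fix x assume "x \<in> V"
      then have "(x, x) \<in> set ps" using loop ps by simp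
      then show "x \<in> set w" unfolding w_def using set_F \<open>x \<in> V\<close> by fastforce
    qed
  qed
  have filter_w: "filter P w = concat (map (\<lambda>(x, y). filter P (F x y)) ps)" for P
    unfolding w_def by (simp add: filter_concat comp_def case_prod_unfold)
  have alt_edge: "alternate_in u v w"
    if "u \<in> V" "v \<in> V" "{u, v} \<in> edges G" "f u < f v" for u v
  proof -
    have "distinct_adj (filter (\<lambda>z. z \<in> {u, v}) w)"
      unfolding filter_w
      using that edge ps by (intro distinct_adj_concat[of u v, THEN conjunct1]) auto
    then show ?thesis using that by (subst alternate_in_iff_distinct_adj) auto
  qed
  have alt_nonedge: "\<not> alternate_in u v w"
    if "u \<in> V" "v \<in> V" "u \<noteq> v" "{u, v} \<notin> edges G" "f u \<le> f v" for u v
  proof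
    assume "alternate_in u v w"
    then have d: "distinct_adj (filter (\<lambda>z. z \<in> {u, v}) w)"
      using that by (simp add: alternate_in_iff_distinct_adj)
    have "(u, v) \<in> set ps" using that ps by simp
    then obtain as bs where "ps = as @ (u, v) # bs" by (meson split_list)
    then have "distinct_adj (filter (\<lambda>z. z \<in> {u, v}) (F u v))"
      using d unfolding filter_w by (auto dest: distinct_adj_appendD)
    then show False using nonedge that by blast
  qed
  have sym: "alternate_in u v w \<longleftrightarrow> alternate_in v u w" for u v
    unfolding alternate_in_def by (auto simp: insert_commute)
  have "alternate_in x y w \<longleftrightarrow> {x, y} \<in> edges G" if "x \<in> V" "y \<in> V" "x \<noteq> y" for x y
  proof (cases "f x \<le> f y")
    case True
    then show ?thesis using that alt_edge alt_nonedge proper by (metis le_neq_implies_less)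
  next
    case False
    then show ?thesis
      using that alt_edge[of y x] alt_nonedge[of y x] sym[of x y] by (auto simp: insert_commute)
  qed
  then show ?thesis
    unfolding word_representable_def V using set_w by blast
qed

text \<open>Edges are read from the smaller to the larger colour, and \<open>L 0 @ L 1 @ L 2\<close>
  respects all of them. For each non-edge a factor with two rounds spoils that pair but no edge.
  Pairs with the larger colour first get the neutral factor, since the opposite order is listed as
  well.\<close>

lemma word_representable_if_3_colourable:
  fixes f :: "'a \<Rightarrow> nat"
  assumes fin: "finite (vertices G)"
    and col: "\<And>x. x \<in> vertices G \<Longrightarrow> f x < 3"
    and proper: "\<And>x y. {x, y} \<in> edges G \<Longrightarrow> x \<in> vertices G \<Longrightarrow> y \<in> vertices G \<Longrightarrow> f x \<noteq> f y"
  shows "word_representable G"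
proof -
  obtain vs where vs: "set vs = vertices G" "distinct vs"
    using finite_distinct_list[OF fin] by blast
  define L where "L i = filter (\<lambda>z. f z = i) vs" for i
  define M where "M i a = filter (\<lambda>z. f z = i \<and> z \<noteq> a) vs" for i a
  text \<open>For colours 0 and 2 all edges are respected (also along paths from \<open>x\<close> to \<open>y\<close>), although both copies of \<open>x\<close> precede both copies of \<open>y\<close>.\<close>
  define F where "F x y =
    (if f x = f y then L 0 @ L 1 @ L 2 @ rev (L 0) @ rev (L 1) @ rev (L 2)
     else if f x = 0 \<and> f y = 1 then L 0 @ L 1 @ L 2 @ M 0 x @ [y, x] @ M 1 y @ L 2
     else if f x = 1 \<and> f y = 2 then L 0 @ L 1 @ L 2 @ L 0 @ M 1 x @ [y, x] @ M 2 y
     else if f x = 0 \<and> f y = 2 then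
       M 0 x @ [x] @ L 1 @ M 2 y @ [x, y] @ M 0 x @ L 1 @ [y] @ M 2 y
     else L 0 @ L 1 @ L 2)" for x y
  have filter_L: "filter (\<lambda>z. z = u \<or> z = v) (L i) =
      (if f u = i then [u] else if f v = i then [v] else [])"
    if "u \<in> vertices G" "v \<in> vertices G" "f u \<noteq> f v" for u v i
    using that vs filter_pair_filter[of vs u v "\<lambda>z. f z = i"] unfolding L_def
    by (simp del: filter_filter)
  have filter_M: "filter (\<lambda>z. z = u \<or> z = v) (M i a) =
      (if f u = i \<and> u \<noteq> a then [u] else if f v = i \<and> v \<noteq> a then [v] else [])"
    if "u \<in> vertices G" "v \<in> vertices G" "f u \<noteq> f v" for u v i a
    using that vs filter_pair_filter[of vs u v "\<lambda>z. f z = i \<and> z \<noteq> a"] unfolding M_def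
    by (simp del: filter_filter)
  have lt3: "f x = 0 \<or> f x = 1 \<or> f x = 2" if "x \<in> vertices G" for x
    using col[OF that] by linarith
  show ?thesis
  proof (rule word_representable_if_factors[OF fin, where f = f and F = F])
    show "f x \<noteq> f y" if "{x, y} \<in> edges G" "x \<in> vertices G" "y \<in> vertices G" for x y
      using proper that .
    show "set (F x y) = vertices G" if "x \<in> vertices G" "y \<in> vertices G" for x y
    proof -
      have *: "set (L i) = {z \<in> vertices G. f z = i}"
        "set (M i a) = {z \<in> vertices G. f z = i \<and> z \<noteq> a}" for i a
        by (auto simp: L_def M_def vs)
      have "set (F x y) \<subseteq> vertices G"
        using that by (simp add: F_def * subset_iff)
      moreover have "z \<in> set (F x y)" if "z \<in> vertices G" for z
        using lt3[OF that] that by (elim disjE) (auto simp: F_def *)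
      ultimately show ?thesis by blast
    qed
    show "filter (\<lambda>z. z \<in> {u, v}) (F x y) \<in> {[u, v], [u, v, u, v]}"
      if "x \<in> vertices G" "y \<in> vertices G" "{x, y} \<notin> edges G" "u \<in> vertices G" "v \<in> vertices G"
        "{u, v} \<in> edges G" "f u < f v" for x y u v
    proof -
      have ne: "\<not> (u = x \<and> v = y)" using that by auto
      have uv: "f u = 0 \<and> f v = 1 \<or> f u = 0 \<and> f v = 2 \<or> f u = 1 \<and> f v = 2"
        using lt3[of u] lt3[of v] that by linarith
      have "f u \<noteq> f v" using that by simp
      note fl = filter_L[OF that(4,5) this] filter_M[OF that(4,5) this]
      show ?thesis
        using uv ne lt3[OF that(1)] lt3[OF that(2)]
        unfolding F_def if_distrib[of "filter _"] insert_iff empty_iff simp_thms filter_append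
          filter.simps rev_filter[symmetric] fl
        by (elim disjE) auto
    qed
    show "\<not> distinct_adj (filter (\<lambda>z. z \<in> {x, y}) (F x y))"
      if "x \<in> vertices G" "y \<in> vertices G" "x \<noteq> y" "f x \<le> f y" "{x, y} \<notin> edges G" for x y
    proof (cases "f x = f y")
      case True
      \<comment> \<open>In \<open>l @ rev l\<close> the last letter of \<open>l\<close> is doubled
        at the seam.\<close>
      define l where "l = filter (\<lambda>z. z = x \<or> z = y) (L (f x))"
      have "l \<noteq> []" using that by (auto simp: l_def L_def filter_empty_conv vs)
      have "filter (\<lambda>z. z = x \<or> z = y) (L i) = (if i = f x then l else [])" for i
        using True by (auto simp: l_def L_def filter_empty_conv)
      then have "filter (\<lambda>z. z \<in> {x, y}) (F x y) = l @ rev l"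
        using True lt3[of x] that by (auto simp: F_def rev_filter[symmetric])
      then show ?thesis
        using \<open>l \<noteq> []\<close> by (simp add: distinct_adj_append_iff hd_rev)
    next
      case False
      note fl = filter_L[OF that(1,2) this] filter_M[OF that(1,2) this]
      have "f x = 0 \<and> f y = 1 \<or> f x = 0 \<and> f y = 2 \<or> f x = 1 \<and> f y = 2"
        using lt3[of x] lt3[of y] that False by linarith
      then show ?thesis
        using that unfolding F_def by (elim disjE) (auto simp: fl)
    qed
  qed simp
qed

section \<open>Colourings of windows\<close>

text \<open>\<open>distinct_adj z\<close> for a word \<open>z\<close> of length \<open>n + 1\<close> amounts to an arc of the graph
  \<open>S\<^sub>1(n, N)\<close> from \<open>butlast z\<close> to \<open>tl z\<close>.\<close>

definition window_3_colourable :: "nat \<Rightarrow> nat \<Rightarrow> bool" where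
  "window_3_colourable n N \<longleftrightarrow> (\<exists>f :: nat list \<Rightarrow> nat.
     (\<forall>x. length x = n \<and> set x \<subseteq> {..<N} \<and> distinct_adj x \<longrightarrow> f x < 3) \<and>
     (\<forall>z. length z = n + 1 \<and> set z \<subseteq> {..<N} \<and> distinct_adj z \<longrightarrow> f (butlast z) \<noteq> f (tl z)))"

text \<open>Consecutive windows begin with adjacent letters, and three letters are already three
  colours.\<close>

lemma window_3_colourable_2_3: "window_3_colourable 2 3"
  unfolding window_3_colourable_def
proof (intro exI[of _ hd] conjI allI impI)
  show "hd x < 3" if "length x = 2 \<and> set x \<subseteq> {..<3} \<and> distinct_adj x" for x :: "nat list"
    using that by (cases x) auto
  show "hd (butlast z) \<noteq> hd (tl z)"
    if "length z = 2 + 1 \<and> set z \<subseteq> {..<3} \<and> distinct_adj z" for z :: "nat list"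
    using that by (cases z rule: remdups_adj.cases) auto
qed

text \<open>Each letter 3 is recoloured by a colour that occurs on neither side.\<close>

lemma window_3_colourable_3_4: "window_3_colourable 3 4"
proof -
  define g :: "nat \<Rightarrow> nat \<Rightarrow> nat \<Rightarrow> nat" where
    "g a b c = (if b < 3 then b else if 0 \<notin> {a, c} then 0 else if 1 \<notin> {a, c} then 1 else 2)" for a b c
  have g: "g a b c < 3" for a b c by (simp add: g_def)
  \<comment> \<open>At most one of \<open>b\<close> and \<open>c\<close> is 3. The colour of the
    window around it avoids its neighbours, in particular the other middle letter, which is the
    colour of the other window.\<close>
  have g': "g a b c \<noteq> g b c d" if "a \<noteq> b" "b \<noteq> c" "c \<noteq> d" "b < 4" "c < 4" for a b c d
    using that unfolding g_def by auto
  show ?thesis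
    unfolding window_3_colourable_def
  proof (intro exI[of _ "\<lambda>x. g (x ! 0) (x ! 1) (x ! 2)"] conjI allI impI)
    fix z :: "nat list"
    assume z: "length z = 3 + 1 \<and> set z \<subseteq> {..<4} \<and> distinct_adj z"
    then have "z ! i < 4" if "i < 4" for i
      using that nth_mem[of i z] by (auto simp: subset_iff)
    moreover have "z ! 0 \<noteq> z ! 1" "z ! 1 \<noteq> z ! 2" "z ! 2 \<noteq> z ! 3"
      unfolding numeral_2_eq_2 numeral_3_eq_3
      using z distinct_adj_conv_nth[THEN iffD1, rule_format, of z 0]
        distinct_adj_conv_nth[THEN iffD1, rule_format, of z 1]
        distinct_adj_conv_nth[THEN iffD1, rule_format, of z 2] by (simp_all add: numeral_2_eq_2)
    ultimately have "g (z ! 0) (z ! 1) (z ! 2) \<noteq> g (z ! 1) (z ! 2) (z ! 3)"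
      by (intro g') auto
    then show "g (butlast z ! 0) (butlast z ! 1) (butlast z ! 2) \<noteq> g (tl z ! 0) (tl z ! 1) (tl z ! 2)"
      using z by (simp add: nth_butlast nth_tl flip: numeral_2_eq_2 numeral_3_eq_3)
  qed (rule g)
qed

text \<open>The two-element subsets of \<open>{..<c}\<close> form an antichain of
  \<open>c choose 2\<close> sets. The element chosen from \<open>S a - S b\<close> lies outside
  \<open>S b\<close> and the next one, from \<open>S b - S d\<close>, inside, so recoded neighbours
  differ. This is the colouring argument for line digraphs.\<close>

lemma window_3_colourable_Suc:
  assumes "window_3_colourable n c" "N \<le> c choose 2"
  shows "window_3_colourable (Suc n) N"
proof -
  obtain f where f: "\<And>x. length x = n \<Longrightarrow> set x \<subseteq> {..<c} \<Longrightarrow> distinct_adj x \<Longrightarrow> f x < (3 :: nat)"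
    and f': "\<And>z. length z = n + 1 \<Longrightarrow> set z \<subseteq> {..<c} \<Longrightarrow> distinct_adj z \<Longrightarrow> f (butlast z) \<noteq> f (tl z)"
    using assms(1) unfolding window_3_colourable_def by blast
  have "card {A. A \<subseteq> {..<c} \<and> card A = 2} = c choose 2"
    using n_subsets[of "{..<c}" 2] by simp
  then obtain S where S: "S ` {..<N} \<subseteq> {A. A \<subseteq> {..<c} \<and> card A = 2}" "inj_on S {..<N}"
    using card_le_inj[of "{..<N}" "{A. A \<subseteq> {..<c} \<and> card A = 2}"] assms(2) by auto
  have S': "S a \<subseteq> {..<c}" "card (S a) = 2" if "a < N" for a
    using S(1) that by (simp_all add: image_subset_iff)
  have fin: "finite (S a)" if "a < N" for a
    using S'(1)[OF that] by (rule finite_subset) simp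
  have ne: "S a - S b \<noteq> {}" if "a < N" "b < N" "a \<noteq> b" for a b
  proof
    assume "S a - S b = {}"
    moreover have "card (S a) = card (S b)" using S' that by simp
    ultimately have "S a = S b" using fin that card_subset_eq[of "S b" "S a"] by blast
    with S(2) that show False by (auto dest: inj_onD)
  qed
  define p where "p a b = (SOME i. i \<in> S a - S b)" for a b
  have p: "p a b \<in> S a - S b" if "a < N" "b < N" "a \<noteq> b" for a b
    unfolding p_def some_in_eq using ne[OF that] .
  define r where "r x = map2 p x (tl x)" for x
  have r_Cons: "r (a # b # x) = p a b # r (b # x)" for a b x
    by (simp add: r_def)
  have len: "length (r x) = length x - 1" for x
    by (simp add: r_def)
  have r: "set (r x) \<subseteq> {..<c} \<and> distinct_adj (r x)" if "set x \<subseteq> {..<N}" "distinct_adj x" for x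
    using that
  proof (induction x)
    case (Cons a x)
    show ?case
    proof (cases x)
      case Nil
      then show ?thesis by (simp add: r_def)
    next
      case (Cons b y)
      have IH: "set (r (b # y)) \<subseteq> {..<c} \<and> distinct_adj (r (b # y))"
        using Cons.IH Cons.prems Cons by auto
      have ab: "p a b \<in> S a - S b" using Cons.prems Cons by (intro p) auto
      moreover have "S a \<subseteq> {..<c}" using S'(1) Cons.prems by simp
      moreover have "p a b \<noteq> hd (r (b # y))" if nonempty: "r (b # y) \<noteq> []"
      proof -
        obtain d u where y: "y = d # u" using nonempty by (cases y) (auto simp: r_def)
        then have "p b d \<in> S b - S d" using Cons.prems Cons by (intro p) auto
        with ab show ?thesis by (auto simp: y r_Cons)
      qed
      ultimately show ?thesis
        using IH by (auto simp: Cons r_Cons distinct_adj_Cons)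
    qed
  qed (simp add: r_def)
  \<comment> \<open>Recoding acts on adjacent pairs, so it commutes with dropping an end letter and
    takes arcs to arcs.\<close>
  have r_tl: "r (tl z) = tl (r z)" for z
    by (cases z rule: remdups_adj.cases) (auto simp: r_def)
  have r_butlast: "r (butlast z) = butlast (r z)" for z
    by (rule nth_equalityI) (auto simp: r_def nth_butlast nth_tl)
  show ?thesis
    unfolding window_3_colourable_def
  proof (intro exI[of _ "\<lambda>x. f (r x)"] conjI allI impI)
    show "f (r x) < 3" if "length x = Suc n \<and> set x \<subseteq> {..<N} \<and> distinct_adj x" for x
      using that r len by (intro f) auto
    show "f (r (butlast z)) \<noteq> f (r (tl z))"
      if "length z = Suc n + 1 \<and> set z \<subseteq> {..<N} \<and> distinct_adj z" for z
      unfolding r_tl r_butlast using that r len by (intro f') auto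
  qed
qed

lemma window_3_colourable_4_6: "window_3_colourable 4 6"
  using window_3_colourable_Suc[OF window_3_colourable_3_4, of 6] by (simp add: choose_two)

text \<open>The base case rests on \<open>10 \<le> 6 choose 2\<close>; afterwards
  \<open>2 * n choose 2\<close> grows quadratically, the required number of letters only
  linearly.\<close>

lemma window_3_colourable_double:
  assumes "n \<ge> 5"
  shows "window_3_colourable n (2 * n)"
  using assms
proof (induction n rule: dec_induct)
  case base
  show ?case
    using window_3_colourable_Suc[OF window_3_colourable_4_6, of 10] by (simp add: choose_two)
next
  case (step n)
  \<comment> \<open>Twice the desired bound, which clears the division by 2 in
    \<open>choose_two\<close>.\<close>
  have "2 * Suc n * 2 \<le> 2 * n * (2 * n - 1)"
  proof -
    have "2 * Suc n * 2 \<le> 2 * n * 9" using step by simp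
    also have "\<dots> \<le> 2 * n * (2 * n - 1)" using step by (intro mult_le_mono) auto
    finally show ?thesis .
  qed
  then have "2 * Suc n \<le> 2 * n choose 2"
    unfolding choose_two by linarith
  then show ?case
    using window_3_colourable_Suc step by simp
qed

lemma window_3_colourable_mono:
  "window_3_colourable n N \<Longrightarrow> N' \<le> N \<Longrightarrow> window_3_colourable n N'"
  unfolding window_3_colourable_def by (meson lessThan_subset_iff order_trans)

section \<open>Transfer from windows to the gap graphs\<close>

lemma word_representable_gap_de_bruijn:
  assumes "m \<ge> 1" "n \<ge> 2" "window_3_colourable n N" "k \<le> N * m"
  shows "word_representable (gap_de_bruijn m n k)"
proof -
  obtain f where f: "\<And>x. length x = n \<Longrightarrow> set x \<subseteq> {..<N} \<Longrightarrow> distinct_adj x \<Longrightarrow> f x < (3 :: nat)"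
    and f': "\<And>z. length z = n + 1 \<Longrightarrow> set z \<subseteq> {..<N} \<Longrightarrow> distinct_adj z \<Longrightarrow> f (butlast z) \<noteq> f (tl z)"
    using assms(3) unfolding window_3_colourable_def by blast
  define B where "B = map (\<lambda>c. c div m)"
  \<comment> \<open>Numbers in one block of \<open>m\<close> consecutive ones differ by less than
    \<open>m\<close>.\<close>
  have div_neq: "a div m \<noteq> b div m" if "int m \<le> \<bar>int a - int b\<bar>" for a b
  proof
    assume eq: "a div m = b div m"
    have "a mod m < m" "b mod m < m" using assms(1) by auto
    moreover have "a = b div m * m + a mod m"
      unfolding eq[symmetric] by simp
    moreover have "b = b div m * m + b mod m" by simp
    ultimately show False using that by linarith
  qed
  have distinct_adj_B: "distinct_adj (B x)"
    if "\<And>i. i + 1 < length x \<Longrightarrow> int m \<le> \<bar>int (x ! i) - int (x ! (i + 1))\<bar>" for x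
    using that div_neq unfolding B_def distinct_adj_conv_nth by (auto simp: nth_map)
  have set_B: "set (B x) \<subseteq> {..<N}" if "set x \<subseteq> {..<k}" for x
    using that assms(1,4) unfolding B_def by (fastforce simp: less_mult_imp_div_less)
  have arc: "f (B x) \<noteq> f (B y)"
    if x: "x \<in> gap_words m n k" and y: "y \<in> gap_words m n k"
      and xy: "\<forall>i. i + 1 < n \<longrightarrow> x ! (i + 1) = y ! i" for x y
  proof -
    \<comment> \<open>The arc spells a word of length \<open>n + 1\<close> whose two windows are
      \<open>x\<close> and \<open>y\<close>.\<close>
    define z where "z = x @ [last y]"
    have len: "length x = n" "length y = n" using x y by (auto simp: gap_words_def)
    then have "y \<noteq> []" using assms(2) by auto
    have last: "last y = y ! (n - 1)" using len \<open>y \<noteq> []\<close> by (simp add: last_conv_nth)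
    have tl: "tl z = y"
      using len assms(2) xy last
      by (intro nth_equalityI) (auto simp: z_def nth_tl nth_append not_less less_Suc_eq_le
          intro!: arg_cong[of _ _ "(!) y"])
    have "int m \<le> \<bar>int (z ! i) - int (z ! (i + 1))\<bar>" if "i + 1 < length z" for i
    proof (cases "i + 1 < n")
      case True
      then show ?thesis using x len by (simp add: z_def nth_append gap_words_def)
    next
      case False
      with that len have i: "i = n - 1" by (simp add: z_def)
      \<comment> \<open>The last gap of \<open>z\<close> is the last gap of \<open>y\<close>, which
        exists because \<open>n \<ge> 2\<close>.\<close>
      have "z ! i = y ! (n - 2)" "z ! (i + 1) = y ! (n - 2 + 1)"
        using i len last assms(2) xy[rule_format, of "n - 2"]
        by (simp_all add: z_def nth_append numeral_2_eq_2 Suc_diff_Suc)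
      then show ?thesis using y assms(2) by (simp add: gap_words_def)
    qed
    then have "distinct_adj (B z)" by (rule distinct_adj_B)
    moreover have "set (B z) \<subseteq> {..<N}"
      using x y last_in_set[OF \<open>y \<noteq> []\<close>] by (intro set_B) (auto simp: z_def gap_words_def)
    moreover have "length (B z) = n + 1" using len by (simp add: B_def z_def)
    ultimately have "f (butlast (B z)) \<noteq> f (tl (B z))" using f' by blast
    moreover have "butlast (B z) = B x" by (simp add: B_def z_def butlast_append)
    moreover have "tl (B z) = B y" unfolding tl[symmetric] by (simp add: B_def map_tl)
    ultimately show ?thesis by simp
  qed
  show ?thesis
  proof (rule word_representable_if_3_colourable[where f = "\<lambda>x. f (B x)"])
    have "gap_words m n k \<subseteq> {x. set x \<subseteq> {..<k} \<and> length x = n}"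
      by (auto simp: gap_words_def)
    then show "finite (vertices (gap_de_bruijn m n k))"
      unfolding vertices_gap_de_bruijn by (rule finite_subset) (simp add: finite_lists_length_eq)
    show "f (B x) < 3" if "x \<in> vertices (gap_de_bruijn m n k)" for x
      using that unfolding vertices_gap_de_bruijn
      by (intro f set_B distinct_adj_B) (auto simp: gap_words_def B_def)
    show "f (B x) \<noteq> f (B y)" if "{x, y} \<in> edges (gap_de_bruijn m n k)" for x y
      using that arc[of x y] arc[of y x] unfolding edge_gap_de_bruijn_iff by metis
  qed
qed

section \<open>The graph on four letters\<close>

text \<open>As a 0-1 matrix, \<open>R\<close> cannot have both a non-constant row and a non-constant
  column. The diagonal entries \<open>R x x\<close> and \<open>R y y\<close> serve to name the
  constant values.\<close>

lemma depends_on_one_argument: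
  assumes "\<And>x x' y y'. x \<in> A \<Longrightarrow> x' \<in> A \<Longrightarrow> y \<in> A \<Longrightarrow> y' \<in> A \<Longrightarrow>
      R x y \<Longrightarrow> \<not> R x' y \<Longrightarrow> R x' y' \<Longrightarrow> False"
    and "\<And>x x' y y'. x \<in> A \<Longrightarrow> x' \<in> A \<Longrightarrow> y \<in> A \<Longrightarrow> y' \<in> A \<Longrightarrow>
      \<not> R x y \<Longrightarrow> R x y' \<Longrightarrow> \<not> R x' y' \<Longrightarrow> False"
  shows "(\<forall>x\<in>A. \<forall>y\<in>A. R x y \<longleftrightarrow> R x x) \<or> (\<forall>x\<in>A. \<forall>y\<in>A. R x y \<longleftrightarrow> R y y)"
proof (rule ccontr)
  assume "\<not> ?thesis"
  then obtain x y x' y' where A: "x \<in> A" "y \<in> A" "x' \<in> A" "y' \<in> A"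
    and neq: "R x y \<noteq> R x x" "R x' y' \<noteq> R y' y'"
    by blast
  obtain y1 y2 where "y1 \<in> A" "y2 \<in> A" "R x y1" "\<not> R x y2"
    using A neq(1) by (cases "R x x") blast+
  moreover obtain x3 x4 where "x3 \<in> A" "x4 \<in> A" "R x3 y'" "\<not> R x4 y'"
    using A neq(2) by (cases "R y' y'") blast+
  \<comment> \<open>The entry \<open>R x4 y1\<close> violates the first assumption if true and the
    second if false.\<close>
  ultimately show False
    using assms(1)[of x3 x4 y' y1] assms(2)[of x x4 y2 y1] A by blast
qed

text \<open>In the following lemmas \<open>D b a c\<close> stands for the orientation \<open>ab \<rightarrow> bc\<close>, which depends only on
  \<open>a\<close> or only on \<open>c\<close>, and \<open>s b a\<close> for \<open>ab \<rightarrow> ba\<close>, so that \<open>s\<close> is a tournament on the letters.\<close>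

lemma arcs_three_alike_path:
  assumes s: "\<And>a b. a \<in> A \<Longrightarrow> b \<in> A \<Longrightarrow> a \<noteq> b \<Longrightarrow> s b a \<longleftrightarrow> \<not> s a b"
    and D: "\<And>a b c. a \<in> A \<Longrightarrow> b \<in> A \<Longrightarrow> c \<in> A \<Longrightarrow> a \<noteq> b \<Longrightarrow> b \<noteq> c \<Longrightarrow>
      D b a c \<longleftrightarrow> (if t b then s b a else s b c)"
    and four: "\<And>a b c d. distinct [a, b, c, d] \<Longrightarrow> {a, b, c, d} \<subseteq> A \<Longrightarrow>
      \<not> (D b a c \<and> D c b d \<and> D d c a)"
    and abcd: "distinct [a, b, c, d]" "{a, b, c, d} \<subseteq> A"
    and t: "t a" "t b" "t c" and path: "s b a" "s c b"
  shows False
proof (cases "t d")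
  \<comment> \<open>Read \<open>s b a\<close> as an arc from \<open>a\<close> to \<open>b\<close>.
    With four letters alike, \<open>four\<close> forbids Hamiltonian paths in this tournament, but
    \<open>d\<close> can always be inserted into the path \<open>a\<close>, \<open>b\<close>,
    \<open>c\<close> (Redei's argument).\<close>
  case True
  have "\<not> s d c" using four[of a b c d] abcd t path True by (auto simp: D)
  moreover have "\<not> s a d" using four[of d a b c] abcd t path True by (auto simp: D)
  ultimately have "s c d" "s d a" using s[of d c] s[of a d] abcd by auto
  then have "\<not> s d b" "\<not> s b d"
    using four[of a b d c] four[of a d b c] abcd t path True by (auto simp: D)
  then show False using s[of b d] abcd by simp
next
  \<comment> \<open>Now \<open>D d c a\<close> depends on \<open>a\<close> instead of
    \<open>c\<close>, so both directions between \<open>a\<close> and \<open>d\<close> are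
    excluded.\<close>
  case False
  have "\<not> s d a" using four[of a b c d] abcd t path False by (auto simp: D)
  moreover have "\<not> s a d" using four[of d a b c] abcd t path False by (auto simp: D)
  ultimately show False using s[of a d] abcd by simp
qed

text \<open>A tournament on three letters has a Hamiltonian path, so the previous lemma applies to
  some order of \<open>a\<close>, \<open>b\<close>, \<open>c\<close>.\<close>

lemma arcs_three_alike:
  assumes s: "\<And>a b. a \<in> A \<Longrightarrow> b \<in> A \<Longrightarrow> a \<noteq> b \<Longrightarrow> s b a \<longleftrightarrow> \<not> s a b"
    and D: "\<And>a b c. a \<in> A \<Longrightarrow> b \<in> A \<Longrightarrow> c \<in> A \<Longrightarrow> a \<noteq> b \<Longrightarrow> b \<noteq> c \<Longrightarrow>
      D b a c \<longleftrightarrow> (if t b then s b a else s b c)"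
    and four: "\<And>a b c d. distinct [a, b, c, d] \<Longrightarrow> {a, b, c, d} \<subseteq> A \<Longrightarrow>
      \<not> (D b a c \<and> D c b d \<and> D d c a)"
    and abcd: "distinct [a, b, c, d]" "{a, b, c, d} \<subseteq> A"
    and t: "t a" "t b" "t c"
  shows False
proof -
  have path: "\<not> (s y x \<and> s z y)" if "distinct [x, y, z, d]" "{x, y, z, d} \<subseteq> A" "t x" "t y" "t z" for x y z
    using arcs_three_alike_path[where s = s and D = D and t = t, OF s D four that] by blast
  have "s a b \<noteq> s b a" "s a c \<noteq> s c a" "s b c \<noteq> s c b"
    using s[of a b] s[of a c] s[of b c] abcd by auto
  moreover have "\<not> (s b a \<and> s c b)" "\<not> (s c a \<and> s b c)" "\<not> (s a b \<and> s c a)"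
    "\<not> (s c b \<and> s a c)" "\<not> (s a c \<and> s b a)" "\<not> (s b c \<and> s a b)"
    using abcd t by (intro path; auto)+
  ultimately show False by blast
qed

text \<open>The cyclic order \<open>a\<close>, \<open>b\<close>, \<open>c\<close>, \<open>d\<close>,
  started at \<open>a\<close> and at \<open>d\<close>, gives the triples \<open>s b a\<close>,
  \<open>s c d\<close>, \<open>s d a\<close> and \<open>s a d\<close>, \<open>s b a\<close>,
  \<open>s c d\<close>, neither constant. As \<open>s d a\<close> and \<open>s a d\<close> are
  opposite, \<open>s b a\<close> and \<open>s c d\<close> differ; exchanging \<open>a\<close> and
  \<open>b\<close> flips only the former.\<close>

lemma arcs_two_and_two:
  assumes s: "\<And>a b. a \<in> A \<Longrightarrow> b \<in> A \<Longrightarrow> a \<noteq> b \<Longrightarrow> s b a \<longleftrightarrow> \<not> s a b"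
    and D: "\<And>a b c. a \<in> A \<Longrightarrow> b \<in> A \<Longrightarrow> c \<in> A \<Longrightarrow> a \<noteq> b \<Longrightarrow> b \<noteq> c \<Longrightarrow>
      D b a c \<longleftrightarrow> (if t b then s b a else s b c)"
    and four: "\<And>a b c d. distinct [a, b, c, d] \<Longrightarrow> {a, b, c, d} \<subseteq> A \<Longrightarrow>
      \<not> (D b a c \<and> D c b d \<and> D d c a) \<and> (D b a c \<or> D c b d \<or> D d c a)"
    and abcd: "distinct [a, b, c, d]" "{a, b, c, d} \<subseteq> A"
    and t: "t a" "t b" "\<not> t c" "\<not> t d"
  shows False
proof -
  have *: "s y x \<noteq> s c d" if "distinct [x, y, c, d]" "{x, y, c, d} \<subseteq> A" "t x" "t y" for x y
  proof -
    have "s d x \<longleftrightarrow> \<not> s x d" using that by (intro s) auto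
    moreover have "\<not> (s y x \<and> s c d \<and> s d x)" "s y x \<or> s c d \<or> s d x"
      using four[of x y c d] that t by (auto simp: D)
    moreover have "\<not> (s x d \<and> s y x \<and> s c d)" "s x d \<or> s y x \<or> s c d"
      using four[of d x y c] that t by (auto simp: D)
    ultimately show ?thesis by blast
  qed
  have "s b a \<noteq> s c d" "s a b \<noteq> s c d" using * abcd t by auto
  then show False using s[of a b] abcd by auto
qed

text \<open>Either three letters share a type or the types split two and two. The condition
  \<open>four\<close> says that the three edges from \<open>ab\<close> via \<open>bc\<close> and
  \<open>cd\<close> to \<open>da\<close> form no directed path in either direction.\<close>

lemma no_arcs_on_four_letters:
  assumes s: "\<And>a b. a \<in> A \<Longrightarrow> b \<in> A \<Longrightarrow> a \<noteq> b \<Longrightarrow> s b a \<longleftrightarrow> \<not> s a b"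
    and D: "\<And>a b c. a \<in> A \<Longrightarrow> b \<in> A \<Longrightarrow> c \<in> A \<Longrightarrow> a \<noteq> b \<Longrightarrow> b \<noteq> c \<Longrightarrow>
      D b a c \<longleftrightarrow> (if t b then s b a else s b c)"
    and four: "\<And>a b c d. distinct [a, b, c, d] \<Longrightarrow> {a, b, c, d} \<subseteq> A \<Longrightarrow>
      \<not> (D b a c \<and> D c b d \<and> D d c a) \<and> (D b a c \<or> D c b d \<or> D d c a)"
    and abcd: "distinct [a, b, c, d]" "{a, b, c, d} \<subseteq> A"
  shows False
proof -
  have three: "\<not> (t x \<and> t y \<and> t z)" if "distinct [x, y, z, u]" "{x, y, z, u} \<subseteq> A" for x y z u
    using arcs_three_alike[where s = s and D = D and t = t, OF s D _ that] four by blast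
  text \<open>Reversing all words exchanges the two types of letters.\<close>
  have three': "\<not> (\<not> t x \<and> \<not> t y \<and> \<not> t z)" if "distinct [x, y, z, u]" "{x, y, z, u} \<subseteq> A" for x y z u
  proof -
    have "D b c a \<longleftrightarrow> (if \<not> t b then s b a else s b c)"
      if "a \<in> A" "b \<in> A" "c \<in> A" "a \<noteq> b" "b \<noteq> c" for a b c
      using D[of c b a] that by auto
    moreover have "\<not> (D b c a \<and> D c d b \<and> D d a c)"
      if "distinct [a, b, c, d]" "{a, b, c, d} \<subseteq> A" for a b c d
      using four[of a d c b] that by auto
    ultimately show ?thesis
      using arcs_three_alike[where s = s and D = "\<lambda>b a c. D b c a" and t = "\<lambda>x. \<not> t x", OF s _ _ that]
      by blast
  qed
  have two: "\<not> (t x \<and> t y \<and> \<not> t z \<and> \<not> t u)" if "distinct [x, y, z, u]" "{x, y, z, u} \<subseteq> A" for x y z u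
    using arcs_two_and_two[where s = s and D = D and t = t, OF s D four that] by blast
  have p: "distinct [a, c, b, d]" "{a, c, b, d} \<subseteq> A" "distinct [a, d, b, c]" "{a, d, b, c} \<subseteq> A"
    "distinct [b, c, d, a]" "{b, c, d, a} \<subseteq> A" "distinct [b, d, a, c]" "{b, d, a, c} \<subseteq> A"
    "distinct [c, d, a, b]" "{c, d, a, b} \<subseteq> A"
    using abcd by auto
  show False
    using three[OF abcd] three[OF p(5,6)] three[OF p(7,8)] three[OF p(9,10)]
      three'[OF abcd] three'[OF p(5,6)] three'[OF p(7,8)] three'[OF p(9,10)]
      two[OF abcd] two[OF p(1,2)] two[OF p(3,4)] two[OF p(5,6)] two[OF p(7,8)] two[OF p(9,10)]
    by blast
qed

section \<open>Non-representability for words of length two\<close>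

lemma not_word_representable_gap_de_bruijn_2:
  assumes "m \<ge> 1" "k \<ge> 3 * m + 1"
  shows "\<not> word_representable (gap_de_bruijn m 2 k)"
proof
  assume "word_representable (gap_de_bruijn m 2 k)"
  then obtain w where set_w: "set w = gap_words m 2 k"
    and alt: "\<And>u v. u \<in> gap_words m 2 k \<Longrightarrow> v \<in> gap_words m 2 k \<Longrightarrow> u \<noteq> v \<Longrightarrow>
      alternate_in u v w \<longleftrightarrow> {u, v} \<in> edges (gap_de_bruijn m 2 k)"
    unfolding word_representable_def vertices_gap_de_bruijn by blast
  define V where "V a b = [a * m, b * m]" for a b
  define ok where "ok a b \<longleftrightarrow> a < 4 \<and> b < 4 \<and> a \<noteq> b" for a b :: nat
  have V_eq_iff: "V a b = V c d \<longleftrightarrow> a = c \<and> b = d" for a b c d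
    using assms(1) by (auto simp: V_def)
  have V_in: "V a b \<in> gap_words m 2 k" if "ok a b" for a b
  proof -
    have "c * m < k" if "c < 4" for c
    proof -
      have "c * m \<le> 3 * m" using that by (intro mult_right_mono) auto
      then show ?thesis using assms(2) by linarith
    qed
    moreover have "int m \<le> \<bar>int (a * m) - int (b * m)\<bar>"
    proof -
      have "int (a * m) - int (b * m) = (int a - int b) * int m" by (simp add: algebra_simps)
      moreover have "1 * int m \<le> \<bar>int a - int b\<bar> * int m"
        using that by (intro mult_right_mono) (auto simp: ok_def)
      ultimately show ?thesis by (simp add: abs_mult)
    qed
    ultimately show ?thesis using that by (auto simp: V_def gap_words_def ok_def)
  qed
  have leads_iff: "leads w (V a b) (V c d) \<or> leads w (V c d) (V a b) \<longleftrightarrow> b = c \<or> d = a"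
    if "ok a b" "ok c d" "V a b \<noteq> V c d" for a b c d
  proof -
    have "leads w (V a b) (V c d) \<or> leads w (V c d) (V a b) \<longleftrightarrow>
        {V a b, V c d} \<in> edges (gap_de_bruijn m 2 k)"
      using that V_in alt alternate_in_iff_leads by metis
    also have "\<dots> \<longleftrightarrow> b = c \<or> d = a"
      unfolding edge_gap_de_bruijn_iff using that V_in assms(1) by (auto simp: V_def less_Suc_eq)
    finally show ?thesis .
  qed
  define R where "R b a c \<longleftrightarrow> leads w (V a b) (V b c)" for a b c
  have not_R_iff: "\<not> R b a c \<longleftrightarrow> leads w (V b c) (V a b)" if "ok a b" "ok b c" for a b c
  proof -
    have "V a b \<noteq> V b c" using that by (simp add: V_eq_iff ok_def)
    then show ?thesis
      unfolding R_def using leads_iff[of a b b c] that leads_antisym[of w "V a b" "V b c"] V_in set_w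
      by blast
  qed
  \<comment> \<open>The ends of the path are adjacent, its first and third vertex are not. The
    closing edge either creates the missing chord by \<open>leads_shortcut\<close> or closes a
    directed 4-cycle.\<close>
  have no_path: False
    if ok: "ok a1 b1" "ok a2 b2" "ok a3 b3" "ok a4 b4"
      and path: "leads w (V a1 b1) (V a2 b2)" "leads w (V a2 b2) (V a3 b3)" "leads w (V a3 b3) (V a4 b4)"
      and closed: "b1 = a4 \<or> b4 = a1"
      and no_chord: "b1 \<noteq> a3" "b3 \<noteq> a1" and ne: "V a1 b1 \<noteq> V a2 b2" "V a1 b1 \<noteq> V a3 b3"
    for a1 a2 a3 a4 b1 b2 b3 b4
  proof -
    have "V a1 b1 \<noteq> V a4 b4" using closed ok by (auto simp: V_eq_iff ok_def)
    then consider "leads w (V a1 b1) (V a4 b4)" | "leads w (V a4 b4) (V a1 b1)"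
      using leads_iff[of a1 b1 a4 b4] ok closed by blast
    then show False
    proof cases
      case 1
      then have "leads w (V a1 b1) (V a3 b3)" by (rule leads_shortcut[OF path])
      then show False using leads_iff[OF ok(1,3) ne(2)] no_chord by simp
    next
      case 2
      then show False using no_closed_4_walk[OF path] V_in[OF ok(1)] ne(1) set_w by simp
    qed
  qed
  text \<open>The arcs \<open>ab \<rightarrow> bc\<close> with fixed \<open>b\<close> form a complete bipartite graph without directed
    paths of length 3.\<close>
  have one_arg: "(\<forall>x\<in>{x. ok x b}. \<forall>y\<in>{x. ok x b}. R b x y \<longleftrightarrow> R b x x) \<or>
        (\<forall>x\<in>{x. ok x b}. \<forall>y\<in>{x. ok x b}. R b x y \<longleftrightarrow> R b y y)" for b
  proof (rule depends_on_one_argument)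
    fix x x' y y'
    assume "x \<in> {x. ok x b}" "x' \<in> {x. ok x b}" "y \<in> {x. ok x b}" "y' \<in> {x. ok x b}"
    then have ok: "ok x b" "ok x' b" "ok b y" "ok b y'" and ne: "b \<noteq> x" "b \<noteq> x'" "b \<noteq> y" "b \<noteq> y'"
      by (auto simp: ok_def)
    show False if R: "R b x y" "\<not> R b x' y" "R b x' y'"
    proof -
      have "leads w (V x b) (V b y)" "leads w (V b y) (V x' b)" "leads w (V x' b) (V b y')"
        using R not_R_iff ok by (simp_all add: R_def)
      moreover have "x \<noteq> x'" using R by auto
      ultimately show False
        using no_path[OF ok(1,3,2,4)] ne by (simp add: V_eq_iff)
    qed
    show False if R: "\<not> R b x y" "R b x y'" "\<not> R b x' y'"
    proof -
      have "leads w (V b y) (V x b)" "leads w (V x b) (V b y')" "leads w (V b y') (V x' b)"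
        using R not_R_iff ok by (simp_all add: R_def)
      moreover have "y \<noteq> y'" using R by auto
      ultimately show False
        using no_path[OF ok(3,1,4,2)] ne by (simp add: V_eq_iff)
    qed
  qed
  \<comment> \<open>If \<open>t b\<close> fails, \<open>one_arg\<close> gives dependence on the
    second letter instead. Either way the value can be read off the diagonal, that is, off the edge
    between \<open>ab\<close> and \<open>ba\<close>.\<close>
  define t where "t b \<longleftrightarrow> (\<forall>x\<in>{x. ok x b}. \<forall>y\<in>{x. ok x b}. R b x y \<longleftrightarrow> R b x x)" for b
  define s where "s b a \<longleftrightarrow> R b a a" for a b
  have R_eq: "R b x y \<longleftrightarrow> (if t b then s b x else s b y)" if "ok x b" "ok b y" for b x y
  proof -
    have *: "x \<in> {x. ok x b}" "y \<in> {x. ok x b}" using that by (auto simp: ok_def)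
    show ?thesis
    proof (cases "t b")
      case True
      then have "R b x y \<longleftrightarrow> R b x x" using * unfolding t_def by blast
      with True show ?thesis by (simp add: s_def)
    next
      case False
      then have "R b x y \<longleftrightarrow> R b y y" using * one_arg[of b] unfolding t_def by blast
      with False show ?thesis by (simp add: s_def)
    qed
  qed
  have tournament: "s b a \<longleftrightarrow> \<not> s a b" if "ok a b" for a b
    using not_R_iff[of a b a] that by (auto simp: s_def R_def ok_def)
  \<comment> \<open>Since the letters are distinct, \<open>ab\<close> and \<open>cd\<close> are not
    adjacent, nor are \<open>bc\<close> and \<open>da\<close>; so \<open>no_path\<close> applies in
    both directions.\<close>
  have four_cycle: "\<not> (R b a c \<and> R c b d \<and> R d c a) \<and> (R b a c \<or> R c b d \<or> R d c a)"
    if "distinct [a, b, c, d]" "a < 4" "b < 4" "c < 4" "d < 4" for a b c d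
  proof -
    have ok: "ok a b" "ok b c" "ok c d" "ok d a" using that by (auto simp: ok_def)
    have "\<not> (R b a c \<and> R c b d \<and> R d c a)"
      using no_path[OF ok] that unfolding R_def by (auto simp: V_eq_iff)
    moreover have "\<not> (\<not> R b a c \<and> \<not> R c b d \<and> \<not> R d c a)"
      unfolding not_R_iff[OF ok(1,2)] not_R_iff[OF ok(2,3)] not_R_iff[OF ok(3,4)]
      using no_path[OF ok(4,3,2,1)] that by (auto simp: V_eq_iff)
    ultimately show ?thesis by blast
  qed
  show False
  proof (rule no_arcs_on_four_letters)
    show "distinct [0 :: nat, 1, 2, 3]" "{0 :: nat, 1, 2, 3} \<subseteq> {..<4}" by auto
    show "s b a \<longleftrightarrow> \<not> s a b" if "a \<in> {..<4}" "b \<in> {..<4}" "a \<noteq> b" for a b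
      using tournament[of a b] that by (simp add: ok_def)
    show "R b a c \<longleftrightarrow> (if t b then s b a else s b c)"
      if "a \<in> {..<4}" "b \<in> {..<4}" "c \<in> {..<4}" "a \<noteq> b" "b \<noteq> c" for a b c
      using R_eq[of a b c] that by (simp add: ok_def)
    show "\<not> (R b a c \<and> R c b d \<and> R d c a) \<and> (R b a c \<or> R c b d \<or> R d c a)"
      if "distinct [a, b, c, d]" "{a, b, c, d} \<subseteq> {..<4}" for a b c d
      using four_cycle[of a b c d] that by simp
  qed
qed

theorem theorem5:
  fixes m n k :: nat
  assumes "m \<ge> 1" and "n \<ge> 1" and "k \<ge> 1"
  shows "((n \<in> {2, 3, 4} \<and> k \<le> (n + 1) * m \<longrightarrow> word_representable (gap_de_bruijn m n k)) \<and>
          (\<forall>k'\<ge>3 * m + 1. \<not> word_representable (gap_de_bruijn m 2 k'))) \<and>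
         (n \<ge> 5 \<and> k \<le> 2 * m * n \<longrightarrow> word_representable (gap_de_bruijn m n k))"
proof (intro conjI allI impI)
  show "word_representable (gap_de_bruijn m n k)" if "n \<in> {2, 3, 4} \<and> k \<le> (n + 1) * m"
  proof -
    \<comment> \<open>For \<open>n = 4\<close> the claim asks for \<open>n + 1 = 5\<close> blocks,
      one fewer than the six available.\<close>
    have "window_3_colourable 4 5"
      using window_3_colourable_4_6 by (rule window_3_colourable_mono) simp
    then have "window_3_colourable n (n + 1)"
      using that window_3_colourable_2_3 window_3_colourable_3_4 by auto
    then show ?thesis
      using that assms(1) by (intro word_representable_gap_de_bruijn[of m n "n + 1"]) auto
  qed
  show "\<not> word_representable (gap_de_bruijn m 2 k')" if "k' \<ge> 3 * m + 1" for k'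
    using not_word_representable_gap_de_bruijn_2 assms(1) that .
  show "word_representable (gap_de_bruijn m n k)" if "n \<ge> 5 \<and> k \<le> 2 * m * n"
    using that assms(1) window_3_colourable_double[of n]
    by (intro word_representable_gap_de_bruijn[of m n "2 * n"]) (auto simp: ac_simps)
qed

end
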